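(* A displacement field $\mathbf{u}:\Omega\to\mathbb{R}^3$ is universal for the monoclinic class $\mathbb{Z}_2$ of linear strain-gradient elastic solids if and only if it is the superposition (sum) of a homogeneous displacement field and a field $(c\,x_2x_3,\,-c\,x_1x_3,\,0)$ for some constant $c\in\mathbb{R}$.
   Context: $\Omega\subset\mathbb{R}^3$ is a nonempty convex open set with Cartesian coordinates $(x_1,x_2,x_3)$ and orthonormal basis $e_1,e_2,e_3$. Repeated indices are summed over $1,2,3$ and a comma denotes partial differentiation. A displacement field is a smooth map $\mathbf{u}:\Omega\to\mathbb{R}^3$, with strain $e_{lm}=\tfrac12(u_{l,m}+u_{m,l})$. It is homogeneous if $\mathbf{u}(\mathbf{x})=\mathbf{H}\mathbf{x}+\mathbf{b}$ for a constant matrix $\mathbf{H}$ and constant vector $\mathbf{b}$. A strain-gradient material is a triple $(\mathsf{C},\mathsf{M},\mathsf{A})$ of constant real tensors of orders $4,5,6$ with index symmetries $\mathsf{C}_{ijlm}=\mathsf{C}_{jilm}=\mathsf{C}_{lmij}$, $\mathsf{M}_{ijklm}=\mathsf{M}_{jiklm}=\mathsf{M}_{ijlkm}$, $\mathsf{A}_{ijklmn}=\mathsf{A}_{jiklmn}=\mathsf{A}_{lmnijk}$. Its stress and hyper-stress are $\sigma_{ij}=\mathsf{C}_{ijlm}e_{lm}+\mathsf{M}_{ijlmn}e_{lm,n}$ and $\tau_{ijk}=\mathsf{M}_{lmijk}e_{lm}+\mathsf{A}_{ijklmn}e_{lm,n}$, and the equilibrium equations without body forces are $\sigma_{ij,j}-\tau_{ijk,jk}=0$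 in $\Omega$ for $i=1,2,3$. For a subgroup $G\subset \mathrm{O}(3)$, a tensor $T$ of order $p$ is $G$-invariant if $Q_{i_1j_1}\cdots Q_{i_pj_p}T_{j_1\dots j_p}=T_{i_1\dots i_p}$ for all $Q\in G$. $\mathbb{Z}_2$ is the group generated by the rotation by $\pi$ about $e_3$, $\mathbb{Z}_2^c=\{I,-I\}$, and $\mathbb{Z}_2\oplus\mathbb{Z}_2^c$ is the group generated by both. The monoclinic class $\mathbb{Z}_2$ is the set of all materials with $\mathsf{C}$ and $\mathsf{A}$ $\mathbb{Z}_2\oplus\mathbb{Z}_2^c$-invariant (13 and 91 independent constants) and $\mathsf{M}$ $\mathbb{Z}_2$-invariant (52 independent constants). A displacement field is universal for the class if it satisfies the equilibrium equations for every material in the class. *)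

theory Defs
  imports "HOL-Analysis.Analysis" "HOL-Algebra.Generated_Groups"
begin

definition partial :: "3 \<Rightarrow> (real^3 \<Rightarrow> real) \<Rightarrow> real^3 \<Rightarrow> real" where
  "partial i f x = deriv (\<lambda>t. f (x + t *\<^sub>R axis i 1)) 0"

text \<open>Fields are total functions, of which only the values on the open set \<open>\<Omega>\<close> matter.
  Asking all iterated partial derivatives to be (Frechet) differentiable on \<open>\<Omega>\<close> says that
  they all exist and are continuous there; as \<open>\<Omega>\<close> is open, their values
  at points of \<open>\<Omega>\<close> depend only on \<open>f\<close> restricted to \<open>\<Omega>\<close>.\<close>

definition smooth_scalar_on :: "(real^3) set \<Rightarrow> (real^3 \<Rightarrow> real) \<Rightarrow> bool" where
  "smooth_scalar_on \<Omega> f \<longleftrightarrow> (\<forall>is. foldr partial is f differentiable_on \<Omega>)"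

definition displacement_field :: "(real^3) set \<Rightarrow> (real^3 \<Rightarrow> real^3) \<Rightarrow> bool" where
  "displacement_field \<Omega> u \<longleftrightarrow> (\<forall>l. smooth_scalar_on \<Omega> (\<lambda>x. u x $ l))"

definition homogeneous_on :: "(real^3) set \<Rightarrow> (real^3 \<Rightarrow> real^3) \<Rightarrow> bool" where
  "homogeneous_on \<Omega> u \<longleftrightarrow> (\<exists>(H::real^3^3) b. \<forall>x\<in>\<Omega>. u x = H *v x + b)"

type_synonym tensor4 = "3 \<Rightarrow> 3 \<Rightarrow> 3 \<Rightarrow> 3 \<Rightarrow> real"
type_synonym tensor5 = "3 \<Rightarrow> 3 \<Rightarrow> 3 \<Rightarrow> 3 \<Rightarrow> 3 \<Rightarrow> real"
type_synonym tensor6 = "3 \<Rightarrow> 3 \<Rightarrow> 3 \<Rightarrow> 3 \<Rightarrow> 3 \<Rightarrow> 3 \<Rightarrow> real"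
type_synonym material = "tensor4 \<times> tensor5 \<times> tensor6"

definition strain_gradient_materials :: "material set" where
  "strain_gradient_materials = {(C, M, A).
     (\<forall>i j l m. C i j l m = C j i l m \<and> C i j l m = C l m i j) \<and>
     (\<forall>i j k l m. M i j k l m = M j i k l m \<and> M i j k l m = M i j l k m) \<and>
     (\<forall>i j k l m n. A i j k l m n = A j i k l m n \<and> A i j k l m n = A l m n i j k)}"

definition strain :: "(real^3 \<Rightarrow> real^3) \<Rightarrow> 3 \<Rightarrow> 3 \<Rightarrow> real^3 \<Rightarrow> real" where
  "strain u l m x = 1/2 * (partial m (\<lambda>y. u y $ l) x + partial l (\<lambda>y. u y $ m) x)"

fun stress :: "material \<Rightarrow> (real^3 \<Rightarrow> real^3) \<Rightarrow> 3 \<Rightarrow> 3 \<Rightarrow> real^3 \<Rightarrow> real" where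
  "stress (C, M, A) u i j x =
     (\<Sum>l\<in>UNIV. \<Sum>m\<in>UNIV. C i j l m * strain u l m x) +
     (\<Sum>l\<in>UNIV. \<Sum>m\<in>UNIV. \<Sum>n\<in>UNIV. M i j l m n * partial n (strain u l m) x)"

fun hyperstress :: "material \<Rightarrow> (real^3 \<Rightarrow> real^3) \<Rightarrow> 3 \<Rightarrow> 3 \<Rightarrow> 3 \<Rightarrow> real^3 \<Rightarrow> real" where
  "hyperstress (C, M, A) u i j k x =
     (\<Sum>l\<in>UNIV. \<Sum>m\<in>UNIV. M l m i j k * strain u l m x) +
     (\<Sum>l\<in>UNIV. \<Sum>m\<in>UNIV. \<Sum>n\<in>UNIV. A i j k l m n * partial n (strain u l m) x)"

definition equilibrium_on :: "(real^3) set \<Rightarrow> material \<Rightarrow> (real^3 \<Rightarrow> real^3) \<Rightarrow> bool" where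
  "equilibrium_on \<Omega> S u \<longleftrightarrow> (\<forall>x\<in>\<Omega>. \<forall>i.
     (\<Sum>j\<in>UNIV. partial j (stress S u i j) x) -
     (\<Sum>j\<in>UNIV. \<Sum>k\<in>UNIV. partial k (partial j (hyperstress S u i j k)) x) = 0)"

definition universal_on ::
  "(real^3) set \<Rightarrow> material set \<Rightarrow> (real^3 \<Rightarrow> real^3) \<Rightarrow> bool" where
  "universal_on \<Omega> cls u \<longleftrightarrow> (\<forall>S\<in>cls. equilibrium_on \<Omega> S u)"

definition O3 :: "(real^3^3) monoid" where
  "O3 = \<lparr>carrier = {Q. orthogonal_matrix Q}, mult = (**), one = mat 1\<rparr>"

definition rotation_e3 :: "real \<Rightarrow> real^3^3" where
  "rotation_e3 \<theta> = vector [vector [cos \<theta>, - sin \<theta>, 0],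
                           vector [sin \<theta>, cos \<theta>, 0],
                           vector [0, 0, 1]]"

definition group_Z2 :: "(real^3^3) set" where
  "group_Z2 = generate O3 {rotation_e3 pi}"

definition group_Z2_Z2c :: "(real^3^3) set" where
  "group_Z2_Z2c = generate O3 {rotation_e3 pi, - mat 1}"

definition invariant4 :: "(real^3^3) set \<Rightarrow> tensor4 \<Rightarrow> bool" where
  "invariant4 G T \<longleftrightarrow> (\<forall>Q\<in>G. \<forall>i1 i2 i3 i4.
     (\<Sum>j1\<in>UNIV. \<Sum>j2\<in>UNIV. \<Sum>j3\<in>UNIV. \<Sum>j4\<in>UNIV.
        Q$i1$j1 * Q$i2$j2 * Q$i3$j3 * Q$i4$j4 * T j1 j2 j3 j4) = T i1 i2 i3 i4)"

definition invariant5 :: "(real^3^3) set \<Rightarrow> tensor5 \<Rightarrow> bool" where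
  "invariant5 G T \<longleftrightarrow> (\<forall>Q\<in>G. \<forall>i1 i2 i3 i4 i5.
     (\<Sum>j1\<in>UNIV. \<Sum>j2\<in>UNIV. \<Sum>j3\<in>UNIV. \<Sum>j4\<in>UNIV. \<Sum>j5\<in>UNIV.
        Q$i1$j1 * Q$i2$j2 * Q$i3$j3 * Q$i4$j4 * Q$i5$j5 * T j1 j2 j3 j4 j5)
     = T i1 i2 i3 i4 i5)"

definition invariant6 :: "(real^3^3) set \<Rightarrow> tensor6 \<Rightarrow> bool" where
  "invariant6 G T \<longleftrightarrow> (\<forall>Q\<in>G. \<forall>i1 i2 i3 i4 i5 i6.
     (\<Sum>j1\<in>UNIV. \<Sum>j2\<in>UNIV. \<Sum>j3\<in>UNIV. \<Sum>j4\<in>UNIV. \<Sum>j5\<in>UNIV. \<Sum>j6\<in>UNIV.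
        Q$i1$j1 * Q$i2$j2 * Q$i3$j3 * Q$i4$j4 * Q$i5$j5 * Q$i6$j6 * T j1 j2 j3 j4 j5 j6)
     = T i1 i2 i3 i4 i5 i6)"

definition monoclinic_Z2 :: "material set" where
  "monoclinic_Z2 = {(C, M, A) \<in> strain_gradient_materials.
     invariant4 group_Z2_Z2c C \<and> invariant5 group_Z2 M \<and> invariant6 group_Z2_Z2c A}"

end

theory Submission
  imports Defs
begin

text \<open>
  Testing equilibrium against the materials \<open>(C, 0, 0)\<close>, where \<open>C\<close> couples a single pair of strain
  components, kills every first derivative of the strain except \<open>e\<^sub>1\<^sub>3\<^sub>,\<^sub>2 = - e\<^sub>2\<^sub>3\<^sub>,\<^sub>1\<close>. By the symmetry
  of mixed partial derivatives that remaining derivative has vanishing gradient, so it is a constant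
  \<open>c / 2\<close>. Then \<open>u\<^sub>i\<^sub>,\<^sub>j\<^sub>k = e\<^sub>i\<^sub>j\<^sub>,\<^sub>k + e\<^sub>i\<^sub>k\<^sub>,\<^sub>j - e\<^sub>j\<^sub>k\<^sub>,\<^sub>i\<close> is constant, and \<open>u\<close> is quadratic with the
  asserted leading part. Conversely, the strain of such a field is affine, so \<open>M\<close> and \<open>A\<close> drop out
  of the equilibrium equations, and the contribution of \<open>C\<close> cancels by its symmetries.
\<close>

section \<open>Partial derivatives and the total derivative\<close>

lemma has_derivative_vec_nth [derivative_intros]:
  fixes f :: "'a::real_normed_vector \<Rightarrow> ('b::real_normed_vector)^'n"
  assumes "(f has_derivative f') F"
  shows "((\<lambda>x. f x $ k) has_derivative (\<lambda>h. f' h $ k)) F"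
  using bounded_linear.has_derivative[OF bounded_linear_vec_nth assms] .

lemma DERIV_along_axis:
  fixes f :: "real^'n \<Rightarrow> real"
  assumes f': "(f has_derivative f') (at (x + t *\<^sub>R axis i 1))"
  shows "((\<lambda>t. f (x + t *\<^sub>R axis i 1)) has_real_derivative f' (axis i 1)) (at t)"
proof -
  have "((\<lambda>t. x + t *\<^sub>R axis i 1) has_derivative (\<lambda>t. t *\<^sub>R axis i 1)) (at t)"
    by (auto intro!: derivative_eq_intros)
  from has_derivative_compose[OF this f']
  have "((\<lambda>t. f (x + t *\<^sub>R axis i 1)) has_derivative (\<lambda>t. f' (t *\<^sub>R axis i 1))) (at t)" .
  moreover have "(\<lambda>t. f' (t *\<^sub>R axis i 1)) = (*) (f' (axis i 1))"
    using linear_cmul[OF has_derivative_linear[OF f']] by auto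
  ultimately show ?thesis
    by (simp add: has_field_derivative_def)
qed

lemma partial_eqI:
  assumes "(f has_derivative f') (at x)"
  shows "partial i f x = f' (axis i 1)"
  unfolding partial_def using assms by (intro DERIV_imp_deriv DERIV_along_axis) simp

lemma has_derivative_partial:
  fixes f :: "real^3 \<Rightarrow> real"
  assumes "f differentiable at x"
  shows "(f has_derivative (\<lambda>h. \<Sum>i\<in>UNIV. h$i * partial i f x)) (at x)"
proof -
  obtain f' where f': "(f has_derivative f') (at x)"
    using assms unfolding differentiable_def by blast
  interpret linear f'
    by (rule has_derivative_linear[OF f'])
  have "f' h = (\<Sum>i\<in>UNIV. h$i * partial i f x)" for h
  proof -
    have "f' h = f' (\<Sum>i\<in>UNIV. h$i *\<^sub>R axis i 1)"
      using basis_expansion[of h] by (simp add: scalar_mult_eq_scaleR)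
    then show ?thesis
      by (simp add: sum scale partial_eqI[OF f'])
  qed
  then show ?thesis
    using f' by (metis (no_types, lifting) ext)
qed

lemma DERIV_along_axis_partial:
  assumes "f differentiable at (x + t *\<^sub>R axis i 1)"
  shows "((\<lambda>t. f (x + t *\<^sub>R axis i 1)) has_real_derivative partial i f (x + t *\<^sub>R axis i 1)) (at t)"
  using assms DERIV_along_axis[of f _ x t i] partial_eqI[of f _ "x + t *\<^sub>R axis i 1" i]
  unfolding differentiable_def by auto

text \<open>Near t = 0 the line through \<open>x\<close> along an axis stays in the open set, so
  \<open>deriv\<close> at 0 sees only values there. This carries identities known only on \<Omega>
  through a derivative.\<close>

lemma partial_cong:
  assumes "open \<Omega>" "x \<in> \<Omega>" and eq: "\<And>y. y \<in> \<Omega> \<Longrightarrow> f y = g y"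
  shows "partial i f x = partial i g x"
proof -
  have "isCont (\<lambda>t. x + t *\<^sub>R axis i (1::real)) 0"
    by (intro continuous_intros)
  then have "\<forall>\<^sub>F t in at (0::real). x + t *\<^sub>R axis i 1 \<in> \<Omega>"
    using topological_tendstoD[of _ x "at (0::real)" \<Omega>] assms(1,2) by (auto simp: isCont_def)
  then have "\<forall>\<^sub>F t in nhds (0::real). x + t *\<^sub>R axis i 1 \<in> \<Omega>"
    using \<open>x \<in> \<Omega>\<close> by (auto simp: eventually_at_filter elim: eventually_mono)
  then have "\<forall>\<^sub>F t in nhds (0::real). f (x + t *\<^sub>R axis i 1) = g (x + t *\<^sub>R axis i 1)"
    by (rule eventually_mono) (use eq in blast)
  then show ?thesis
    unfolding partial_def by (intro deriv_cong_ev) auto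
qed

lemma partial_const [simp]: "partial i (\<lambda>x. c) x = 0"
  by (simp add: partial_def)

lemma partial_zero_on:
  assumes "open \<Omega>" "x \<in> \<Omega>" "\<And>y. y \<in> \<Omega> \<Longrightarrow> f y = (0::real)"
  shows "partial i f x = 0"
  using partial_cong[OF assms(1,2), of f "\<lambda>_. 0"] assms(3) by simp

section \<open>Smooth scalar fields and the symmetry of mixed partial derivatives\<close>

lemma smooth_scalar_on_partial:
  assumes "smooth_scalar_on \<Omega> f"
  shows "smooth_scalar_on \<Omega> (partial i f)"
  unfolding smooth_scalar_on_def
proof
  fix js
  \<comment> \<open>\<open>foldr\<close> applies the last index of the list first, so appending
    \<open>i\<close> differentiates \<open>f\<close> by \<open>i\<close> before
    \<open>js\<close>.\<close>
  have "foldr partial (js @ [i]) f differentiable_on \<Omega>"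
    using assms unfolding smooth_scalar_on_def by blast
  then show "foldr partial js (partial i f) differentiable_on \<Omega>"
    by simp
qed

lemma smooth_scalar_on_differentiable:
  assumes "smooth_scalar_on \<Omega> f" "open \<Omega>" "x \<in> \<Omega>"
  shows "f differentiable at x"
proof -
  have "foldr partial [] f differentiable_on \<Omega>"
    using assms(1) unfolding smooth_scalar_on_def by blast
  then show ?thesis
    using assms(2,3) by (simp add: differentiable_on_eq_differentiable_at)
qed

text \<open>The mean value theorem is used twice: along axis \<open>i\<close> for the difference of
  \<open>f\<close> between opposite sides of the square, then along axis \<open>j\<close> for
  \<open>partial i f\<close>.\<close>

lemma second_difference_MVT:
  fixes f :: "real^3 \<Rightarrow> real"
  assumes "smooth_scalar_on \<Omega> f" "open \<Omega>" "h > 0"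
    and box: "\<And>s t. 0 \<le> s \<Longrightarrow> s \<le> h \<Longrightarrow> 0 \<le> t \<Longrightarrow> t \<le> h \<Longrightarrow> x + s *\<^sub>R axis i 1 + t *\<^sub>R axis j 1 \<in> \<Omega>"
  obtains s t where "0 < s" "s < h" "0 < t" "t < h"
    "f (x + h *\<^sub>R axis i 1 + h *\<^sub>R axis j 1) - f (x + h *\<^sub>R axis i 1) - f (x + h *\<^sub>R axis j 1) + f x
      = h\<^sup>2 * partial j (partial i f) (x + s *\<^sub>R axis i 1 + t *\<^sub>R axis j 1)"
proof -
  define p where "p s t = x + s *\<^sub>R axis i 1 + t *\<^sub>R axis j 1" for s t
  have diff: "f differentiable at (p s t)" "partial i f differentiable at (p s t)"
    if "0 \<le> s" "s \<le> h" "0 \<le> t" "t \<le> h" for s t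
    using that box assms smooth_scalar_on_partial smooth_scalar_on_differentiable
    unfolding p_def by blast+
  have "((\<lambda>s. f (p s h) - f (p s 0)) has_real_derivative partial i f (p s h) - partial i f (p s 0)) (at s)"
    if s: "0 \<le> s" "s \<le> h" for s
    using DERIV_along_axis_partial[of f "x + h *\<^sub>R axis j 1" s i] DERIV_along_axis_partial[of f "x" s i]
      diff[of s h] diff[of s 0] s \<open>h > 0\<close>
    by (intro DERIV_diff) (simp_all add: p_def algebra_simps)
  from MVT2[OF \<open>h > 0\<close> this] obtain s where s: "0 < s" "s < h"
    and 1: "f (p h h) - f (p h 0) - (f (p 0 h) - f (p 0 0)) = h * (partial i f (p s h) - partial i f (p s 0))"
    by auto
  have "((\<lambda>t. partial i f (p s t)) has_real_derivative partial j (partial i f) (p s t)) (at t)"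
    if "0 \<le> t" "t \<le> h" for t
    using DERIV_along_axis_partial[of "partial i f" "x + s *\<^sub>R axis i 1" t j] diff(2)[of s t] s that
    by (simp add: p_def)
  from MVT2[OF \<open>h > 0\<close> this] obtain t where t: "0 < t" "t < h"
    and 2: "partial i f (p s h) - partial i f (p s 0) = h * partial j (partial i f) (p s t)"
    by auto
  show thesis
    using that[OF s t] 1 2 by (simp add: p_def power2_eq_square)
qed

text \<open>The second difference over a square of side h is symmetric in \<open>i\<close> and
  \<open>j\<close>, so \<open>second_difference_MVT\<close> writes it as h^2 times either mixed
  derivative, each at some point of the square. Both derivatives are continuous at \<open>x\<close>,
  hence they agree there up to any \<open>e\<close>.\<close>

lemma partial_commute:
  fixes f :: "real^3 \<Rightarrow> real"
  assumes f: "smooth_scalar_on \<Omega> f" and "open \<Omega>" "x \<in> \<Omega>"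
  shows "partial i (partial j f) x = partial j (partial i f) x"
proof -
  define F where "F k l = partial k (partial l f)" for k l
  obtain r where r: "r > 0" "ball x r \<subseteq> \<Omega>"
    using assms openE by blast
  have near: "dist (x + s *\<^sub>R axis k 1 + t *\<^sub>R axis l 1) x < 3 * h"
    if "0 \<le> s" "s \<le> h" "0 \<le> t" "t \<le> h" "h > 0" for s t h :: real and k l
  proof -
    have "norm (s *\<^sub>R axis k (1::real) + t *\<^sub>R axis l 1) \<le> s + t"
      using that by (intro norm_triangle_le) simp
    then show ?thesis
      using that by (simp add: dist_norm add.assoc)
  qed
  have "isCont (F k l) x" for k l
    unfolding F_def
    by (intro differentiable_imp_continuous_within smooth_scalar_on_differentiable[of \<Omega>]
        smooth_scalar_on_partial assms)
  then have cont: "\<exists>d>0. \<forall>y. dist y x < d \<longrightarrow> dist (F k l y) (F k l x) < e" if "e > 0" for e k l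
    using that unfolding continuous_at_eps_delta by blast
  have "dist (F i j x) (F j i x) \<le> e" if "e > 0" for e
  proof -
    obtain d where d: "d > 0" "\<And>y. dist y x < d \<Longrightarrow> dist (F i j y) (F i j x) < e/2"
      using cont[of "e/2" i j] \<open>e > 0\<close> by auto
    obtain d' where d': "d' > 0" "\<And>y. dist y x < d' \<Longrightarrow> dist (F j i y) (F j i x) < e/2"
      using cont[of "e/2" j i] \<open>e > 0\<close> by auto
    \<comment> \<open>By \<open>near\<close>, points of the square lie within 3h of
      \<open>x\<close>. The choice keeps them in \<Omega> and inside both continuity radii.\<close>
    define h where "h = min r (min d d') / 3"
    have h: "h > 0" "3 * h \<le> r" "3 * h \<le> d" "3 * h \<le> d'"
      using r d d' by (auto simp: h_def)
    have box: "x + s *\<^sub>R axis k 1 + t *\<^sub>R axis l 1 \<in> \<Omega>"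
      if "0 \<le> s" "s \<le> h" "0 \<le> t" "t \<le> h" for s t k l
      using near[OF that h(1), of k l] h r by (auto simp: subset_iff dist_commute)
    obtain s t where st: "0 < s" "s < h" "0 < t" "t < h"
      and eq: "f (x + h *\<^sub>R axis i 1 + h *\<^sub>R axis j 1) - f (x + h *\<^sub>R axis i 1) - f (x + h *\<^sub>R axis j 1) + f x
      = h\<^sup>2 * F j i (x + s *\<^sub>R axis i 1 + t *\<^sub>R axis j 1)"
      using second_difference_MVT[OF f \<open>open \<Omega>\<close> h(1), of x i j] box unfolding F_def by metis
    obtain s' t' where st': "0 < s'" "s' < h" "0 < t'" "t' < h"
      and eq': "f (x + h *\<^sub>R axis j 1 + h *\<^sub>R axis i 1) - f (x + h *\<^sub>R axis j 1) - f (x + h *\<^sub>R axis i 1) + f x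
      = h\<^sup>2 * F i j (x + s' *\<^sub>R axis j 1 + t' *\<^sub>R axis i 1)"
      using second_difference_MVT[OF f \<open>open \<Omega>\<close> h(1), of x j i] box unfolding F_def by metis
    have "h\<^sup>2 * F j i (x + s *\<^sub>R axis i 1 + t *\<^sub>R axis j 1) = h\<^sup>2 * F i j (x + s' *\<^sub>R axis j 1 + t' *\<^sub>R axis i 1)"
      unfolding eq[symmetric] eq'[symmetric] by (simp add: algebra_simps)
    then have "F j i (x + s *\<^sub>R axis i 1 + t *\<^sub>R axis j 1) = F i j (x + s' *\<^sub>R axis j 1 + t' *\<^sub>R axis i 1)"
      using h(1) by simp
    moreover have "dist (F j i (x + s *\<^sub>R axis i 1 + t *\<^sub>R axis j 1)) (F j i x) < e/2"
      using near[of s h t i j] st h by (intro d') auto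
    moreover have "dist (F i j (x + s' *\<^sub>R axis j 1 + t' *\<^sub>R axis i 1)) (F i j x) < e/2"
      using near[of s' h t' j i] st' h by (intro d) auto
    ultimately show ?thesis
      unfolding dist_real_def by linarith
  qed
  then have "dist (F i j x) (F j i x) \<le> 0"
    by (rule field_le_epsilon) simp
  then show ?thesis
    by (simp add: F_def)
qed

section \<open>Integration of fields with prescribed partial derivatives\<close>

lemma equal_partials_differ_by_const:
  fixes f g :: "real^3 \<Rightarrow> real"
  assumes "open \<Omega>" "connected \<Omega>"
    and f: "\<And>x. x \<in> \<Omega> \<Longrightarrow> f differentiable at x" and g: "\<And>x. x \<in> \<Omega> \<Longrightarrow> g differentiable at x"
    and eq: "\<And>x i. x \<in> \<Omega> \<Longrightarrow> partial i f x = partial i g x"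
  obtains b where "\<And>x. x \<in> \<Omega> \<Longrightarrow> f x = g x + b"
proof (cases "\<Omega> = {}")
  case False
  then obtain a where "a \<in> \<Omega>"
    by blast
  have "((\<lambda>x. f x - g x) has_derivative (\<lambda>h. 0)) (at x)" if "x \<in> \<Omega>" for x
    using has_derivative_diff[OF has_derivative_partial[OF f[OF that]] has_derivative_partial[OF g[OF that]]]
    by (simp add: eq[OF that])
  then have "f x - g x = f a - g a" if "x \<in> \<Omega>" for x
    using has_derivative_zero_unique_connected[OF assms(1,2)] that \<open>a \<in> \<Omega>\<close> by blast
  then show ?thesis
    by (metis that add.commute diff_add_cancel)
qed (use that in blast)

text \<open>Integrate twice: each first derivative is affine, and \<open>f\<close> is then compared
  with an explicit primitive \<open>g\<close>. Symmetry of \<open>K\<close> makes the two halves of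
  the gradient of the quadratic form equal, which accounts for the factor 1/2.\<close>

lemma constant_second_partials_imp_quadratic:
  fixes f :: "real^3 \<Rightarrow> real" and K :: "3 \<Rightarrow> 3 \<Rightarrow> real"
  assumes \<Omega>: "open \<Omega>" "connected \<Omega>" and f: "smooth_scalar_on \<Omega> f"
    and K: "\<And>x j k. x \<in> \<Omega> \<Longrightarrow> partial k (partial j f) x = K j k" and K_sym: "\<And>j k. K j k = K k j"
  obtains b b0 where
    "\<And>x. x \<in> \<Omega> \<Longrightarrow> f x = (\<Sum>j\<in>UNIV. \<Sum>k\<in>UNIV. K j k * x$j * x$k) / 2 + (\<Sum>j\<in>UNIV. b j * x$j) + b0"
proof -
  have "\<exists>b. \<forall>x\<in>\<Omega>. partial j f x = (\<Sum>k\<in>UNIV. K j k * x$k) + b" for j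
  proof -
    have d: "((\<lambda>x. \<Sum>k\<in>UNIV. K j k * x$k) has_derivative (\<lambda>h. \<Sum>k\<in>UNIV. K j k * h$k)) (at x)" for x
      by (auto intro!: derivative_eq_intros)
    then have dg: "(\<lambda>x. \<Sum>k\<in>UNIV. K j k * x$k) differentiable at x" for x
      unfolding differentiable_def by blast
    have "partial l (partial j f) x = partial l (\<lambda>x. \<Sum>k\<in>UNIV. K j k * x$k) x" if "x \<in> \<Omega>" for l x
      unfolding K[OF that] partial_eqI[OF d] by (simp add: axis_def if_distrib cong: if_cong)
    then obtain b where "\<And>x. x \<in> \<Omega> \<Longrightarrow> partial j f x = (\<Sum>k\<in>UNIV. K j k * x$k) + b"
      using equal_partials_differ_by_const[OF \<Omega> smooth_scalar_on_differentiable[OF smooth_scalar_on_partial[OF f] \<Omega>(1)]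
          dg] by blast
    then show ?thesis
      by blast
  qed
  then obtain b where b: "\<And>x j. x \<in> \<Omega> \<Longrightarrow> partial j f x = (\<Sum>k\<in>UNIV. K j k * x$k) + b j"
    by metis
  define g where "g x = (\<Sum>j\<in>UNIV. \<Sum>k\<in>UNIV. K j k * x$j * x$k) / 2 + (\<Sum>j\<in>UNIV. b j * x$j)"
    for x :: "real^3"
  have d: "(g has_derivative (\<lambda>h. (\<Sum>j\<in>UNIV. \<Sum>k\<in>UNIV. K j k * (x$j * h$k + h$j * x$k)) / 2
      + (\<Sum>j\<in>UNIV. b j * h$j))) (at x)" for x
    unfolding g_def
    by (auto intro!: derivative_eq_intros sum.cong simp: fun_eq_iff algebra_simps)
  then have dg: "g differentiable at x" for x
    unfolding differentiable_def by blast
  have "partial l f x = partial l g x" if "x \<in> \<Omega>" for l x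
  proof -
    have "(\<Sum>j\<in>UNIV. \<Sum>k\<in>UNIV. K j k * (x$j * axis l 1$k + axis l 1$j * x$k))
      = (\<Sum>j\<in>UNIV. \<Sum>k\<in>UNIV. K j k * (x$j * axis l 1$k)) + (\<Sum>j\<in>UNIV. \<Sum>k\<in>UNIV. K j k * (axis l 1$j * x$k))"
      by (simp add: distrib_left sum.distrib)
    also have "\<dots> = (\<Sum>j\<in>UNIV. K j l * x$j) + (\<Sum>k\<in>UNIV. K l k * x$k)"
      \<comment> \<open>Swapping the second double sum makes the index paired with
        \<open>axis l 1\<close> the inner one, so that both inner sums collapse.\<close>
      by (subst (2) sum.swap) (simp add: axis_def if_distrib if_distribR cong: if_cong)
    finally show ?thesis
      unfolding partial_eqI[OF d] b[OF that]
      by (simp add: axis_def if_distrib K_sym[of _ l] cong: if_cong)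
  qed
  then obtain b0 where "\<And>x. x \<in> \<Omega> \<Longrightarrow> f x = g x + b0"
    using equal_partials_differ_by_const[OF \<Omega> smooth_scalar_on_differentiable[OF f \<Omega>(1)] dg]
    by blast
  then show thesis
    using that[of b b0] unfolding g_def by blast
qed


section \<open>Linear combinations and the strain\<close>

lemma partial_lincomb:
  fixes f g :: "real^3 \<Rightarrow> real"
  assumes "f differentiable at x" "g differentiable at x"
  shows "partial i (\<lambda>x. a * f x + b * g x) x = a * partial i f x + b * partial i g x"
proof -
  have "((\<lambda>x. a * f x + b * g x) has_derivative
     (\<lambda>h. a * (\<Sum>i\<in>UNIV. h$i * partial i f x) + b * (\<Sum>i\<in>UNIV. h$i * partial i g x))) (at x)"
    by (intro derivative_intros has_derivative_partial assms)
  from partial_eqI[OF this, of i] show ?thesis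
    by (simp add: axis_def if_distribR if_distrib cong: if_cong)
qed

text \<open>The identity holds only on \<Omega>, so the induction keeps \<open>x\<close> arbitrary
  and passes under the next derivative by \<open>partial_cong\<close>.\<close>

lemma foldr_partial_lincomb:
  assumes "smooth_scalar_on \<Omega> f" "smooth_scalar_on \<Omega> g" "open \<Omega>" "x \<in> \<Omega>"
  shows "foldr partial js (\<lambda>x. a * f x + b * g x) x = a * foldr partial js f x + b * foldr partial js g x"
  using \<open>x \<in> \<Omega>\<close>
proof (induction js arbitrary: x)
  case (Cons j js)
  have "foldr partial js f differentiable at x" "foldr partial js g differentiable at x"
    using assms(1-3) Cons.prems
    by (auto simp: smooth_scalar_on_def differentiable_on_eq_differentiable_at)
  then show ?case
    using partial_cong[OF \<open>open \<Omega>\<close> Cons.prems Cons.IH] by (simp add: partial_lincomb)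
qed simp

lemma smooth_scalar_on_lincomb:
  assumes "smooth_scalar_on \<Omega> f" "smooth_scalar_on \<Omega> g" "open \<Omega>"
  shows "smooth_scalar_on \<Omega> (\<lambda>x. a * f x + b * g x)"
  unfolding smooth_scalar_on_def
proof
  fix js
  have lincomb: "(\<lambda>x. a * foldr partial js f x + b * foldr partial js g x) differentiable_on \<Omega>"
    using assms unfolding smooth_scalar_on_def
    by (intro differentiable_on_add differentiable_on_mult) auto
  show "foldr partial js (\<lambda>x. a * f x + b * g x) differentiable_on \<Omega>"
    unfolding differentiable_on_def
  proof
    fix x assume "x \<in> \<Omega>"
    with lincomb have "(\<lambda>x. a * foldr partial js f x + b * foldr partial js g x) differentiable at x within \<Omega>"
      unfolding differentiable_on_def by blast
    then show "foldr partial js (\<lambda>x. a * f x + b * g x) differentiable at x within \<Omega>"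
      using zero_less_one \<open>x \<in> \<Omega>\<close>
      by (rule differentiable_transform_within) (rule foldr_partial_lincomb[OF assms, symmetric])
  qed
qed

lemma strain_commute: "strain u l m = strain u m l"
  by (auto simp: strain_def)

lemma strain_lincomb:
  "strain u l m = (\<lambda>x. 1/2 * partial m (\<lambda>y. u y $ l) x + 1/2 * partial l (\<lambda>y. u y $ m) x)"
  by (auto simp: strain_def)

lemma smooth_strain:
  assumes "displacement_field \<Omega> u" "open \<Omega>"
  shows "smooth_scalar_on \<Omega> (strain u l m)"
  unfolding strain_lincomb using assms
  by (intro smooth_scalar_on_lincomb smooth_scalar_on_partial) (auto simp: displacement_field_def)

text \<open>Expanding the strains gives six second derivatives of \<open>u\<close>. After exchanging
  mixed partials, those of components \<open>j\<close> and \<open>k\<close> cancel, and the two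
  halves of u_i,jk remain. The strain gradient thus determines all second derivatives.\<close>

lemma second_partial_eq_strain_gradients:
  assumes u: "displacement_field \<Omega> u" and "open \<Omega>" "x \<in> \<Omega>"
  shows "partial k (partial j (\<lambda>y. u y $ i)) x =
    partial k (strain u i j) x + partial j (strain u i k) x - partial i (strain u j k) x"
proof -
  have smooth: "smooth_scalar_on \<Omega> (\<lambda>y. u y $ l)" for l
    using u unfolding displacement_field_def by blast
  have "partial n (strain u l m) x
    = 1/2 * partial n (partial m (\<lambda>y. u y $ l)) x + 1/2 * partial n (partial l (\<lambda>y. u y $ m)) x" for l m n
    unfolding strain_lincomb
    by (intro partial_lincomb smooth_scalar_on_differentiable[OF smooth_scalar_on_partial[OF smooth] assms(2,3)])
  then show ?thesis
    using partial_commute[OF smooth assms(2,3), of i j k] partial_commute[OF smooth assms(2,3), of j k i]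
      partial_commute[OF smooth assms(2,3), of k i j]
    by simp
qed

section \<open>The symmetry group and the invariant elasticity tensors\<close>

lemma invariance_sum_diagonal:
  fixes Q :: "real^3^3"
  assumes "\<And>i j. Q$i$j = (if i = j then q i else 0)"
  shows "(\<Sum>j1\<in>UNIV. \<Sum>j2\<in>UNIV. \<Sum>j3\<in>UNIV. \<Sum>j4\<in>UNIV.
      Q$i1$j1 * Q$i2$j2 * Q$i3$j3 * Q$i4$j4 * T j1 j2 j3 j4) = q i1 * q i2 * q i3 * q i4 * T i1 i2 i3 i4"
proof -
  have "(\<Sum>j\<in>UNIV. Q$i$j * f j) = q i * f i" for i f
    by (simp add: assms if_distribR if_distrib cong: if_cong)
  then show ?thesis
    by (simp add: mult.assoc flip: sum_distrib_left)
qed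

lemma rotation_e3_pi: "rotation_e3 pi $ i $ j = (if i = j then if i = 3 then 1 else -1 else 0)"
  using exhaust_3[of i] exhaust_3[of j] by (auto simp: rotation_e3_def)

text \<open>The inverse is a definite description, so uniqueness is part of the proof: multiplying
  \<open>Q ** P = mat 1\<close> by \<open>Q\<close> on the left gives \<open>P = Q\<close>.\<close>

lemma O3_inv_involution:
  assumes "transpose Q = Q" "Q ** Q = mat 1"
  shows "inv\<^bsub>O3\<^esub> Q = Q"
  unfolding m_inv_def
proof (rule the_equality)
  show "Q \<in> carrier O3 \<and> Q \<otimes>\<^bsub>O3\<^esub> Q = \<one>\<^bsub>O3\<^esub> \<and> Q \<otimes>\<^bsub>O3\<^esub> Q = \<one>\<^bsub>O3\<^esub>"
    using assms by (simp add: O3_def orthogonal_matrix_def)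
  show "P = Q" if "P \<in> carrier O3 \<and> Q \<otimes>\<^bsub>O3\<^esub> P = \<one>\<^bsub>O3\<^esub> \<and> P \<otimes>\<^bsub>O3\<^esub> Q = \<one>\<^bsub>O3\<^esub>" for P
    using that assms matrix_mul_assoc[of Q Q P] by (simp add: O3_def)
qed

text \<open>The generators are diag(-1,-1,1) and diag(-1,-1,-1). Matrices diag(s,s,t) with signs s
  and t are their own inverses and are closed under products, so this form survives the induction
  over \<open>generate\<close>.\<close>

lemma group_Z2_Z2c_diagonal:
  assumes "Q \<in> group_Z2_Z2c"
  obtains s t where "s * s = 1" "t * t = 1" "\<And>i j. Q$i$j = (if i = j then if i = 3 then t else s else 0)"
proof -
  have gen: "\<exists>s t. s * s = 1 \<and> t * t = 1 \<and> (\<forall>i j. Q$i$j = (if i = j then if i = 3 then t else s else 0))"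
    if "Q \<in> {rotation_e3 pi, - mat 1}" for Q :: "real^3^3"
  proof (cases "Q = rotation_e3 pi")
    case True
    then show ?thesis
      by (intro exI[of _ "-1"] exI[of _ 1]) (simp add: rotation_e3_pi)
  next
    case False
    then have "Q = - mat 1"
      using that by simp
    then show ?thesis
      by (intro exI[of _ "-1"] exI[of _ "-1"]) (simp add: mat_def)
  qed
  have "\<exists>s t. s * s = 1 \<and> t * t = 1 \<and> (\<forall>i j. Q$i$j = (if i = j then if i = 3 then t else s else 0))"
    using assms unfolding group_Z2_Z2c_def
  proof (induction rule: generate.induct)
    case one
    show ?case
      by (intro exI[of _ 1]) (simp add: O3_def mat_def)
  next
    case (incl Q)
    then show ?case by (rule gen)
  next
    case (inv Q)
    obtain s t where Q: "s * s = 1" "t * t = 1" "\<And>i j. Q$i$j = (if i = j then if i = 3 then t else s else 0)"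
      using gen[OF inv] by blast
    have "inv\<^bsub>O3\<^esub> Q = Q"
      using Q by (intro O3_inv_involution)
        (auto simp: vec_eq_iff forall_3 transpose_def matrix_matrix_mult_def sum_3 mat_def)
    with gen[OF inv] show ?case by simp
  next
    case (eng P Q)
    obtain s t where P: "s * s = 1" "t * t = 1" "\<And>i j. P$i$j = (if i = j then if i = 3 then t else s else 0)"
      using eng.IH(1) by blast
    obtain s' t' where Q: "s' * s' = 1" "t' * t' = 1" "\<And>i j. Q$i$j = (if i = j then if i = 3 then t' else s' else 0)"
      using eng.IH(2) by blast
    have "(s * s') * (s * s') = (s * s) * (s' * s')" "(t * t') * (t * t') = (t * t) * (t' * t')"
      by (simp_all add: mult_ac)
    then show ?case
      using P Q by (intro exI[of _ "s * s'"] exI[of _ "t * t'"])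
        (auto simp: O3_def matrix_matrix_mult_def forall_3 sum_3)
  qed
  then show thesis
    using that by blast
qed

text \<open>Under diag(s,s,t) a component with q indices equal to 3 is multiplied by s^(4-q) t^q.
  For even q both exponents are even and the factor is 1; for odd q the component is zero by
  assumption.\<close>

lemma elastic_material_in_monoclinic_Z2:
  assumes sym: "\<And>i j l m. C i j l m = C j i l m" "\<And>i j l m. C i j l m = C l m i j"
    and van: "\<And>i j l m. odd (length (filter ((=) 3) [i, j, l, m])) \<Longrightarrow> C i j l m = 0"
  shows "(C, \<lambda>_ _ _ _ _. 0, \<lambda>_ _ _ _ _ _. 0) \<in> monoclinic_Z2"
proof -
  have "invariant4 group_Z2_Z2c C"
    unfolding invariant4_def
  proof (intro ballI allI)
    fix Q i1 i2 i3 i4 assume "Q \<in> group_Z2_Z2c"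
    then obtain s t where s: "s * s = 1" and t: "t * t = 1"
      and Q: "\<And>i j. Q$i$j = (if i = j then if i = 3 then t else s else 0)"
      by (rule group_Z2_Z2c_diagonal) blast
    have [simp]: "s * (s * r) = r" "t * (t * r) = r" for r
      using s t by (simp_all flip: mult.assoc)
    show "(\<Sum>j1\<in>UNIV. \<Sum>j2\<in>UNIV. \<Sum>j3\<in>UNIV. \<Sum>j4\<in>UNIV.
        Q$i1$j1 * Q$i2$j2 * Q$i3$j3 * Q$i4$j4 * C j1 j2 j3 j4) = C i1 i2 i3 i4"
      using van[of i1 i2 i3 i4] unfolding invariance_sum_diagonal[OF Q]
      by (auto simp: mult_ac s t split: if_splits)
  qed
  moreover have "\<forall>i j l m. C i j l m = C j i l m \<and> C i j l m = C l m i j"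
    using sym by blast
  ultimately show ?thesis
    by (simp add: monoclinic_Z2_def strain_gradient_materials_def invariant5_def invariant6_def)
qed

text \<open>An odd number of indices 3 among four leaves an odd number of factors -1 under the
  rotation by pi, so invariance equates the component with its negative.\<close>

lemma monoclinic_Z2_elasticity_vanish:
  assumes "(C, M, A) \<in> monoclinic_Z2" "odd (length (filter ((=) 3) [i, j, l, m]))"
  shows "C i j l m = 0"
proof -
  have "rotation_e3 pi \<in> group_Z2_Z2c"
    unfolding group_Z2_Z2c_def by (rule generate.incl) simp
  then have "(if i = 3 then 1 else -1) * (if j = 3 then 1 else -1) * (if l = 3 then 1 else -1) *
      (if m = 3 then 1 else -1) * C i j l m = C i j l m"
    using assms(1) invariance_sum_diagonal[OF rotation_e3_pi, of i j l m C]
    by (simp add: monoclinic_Z2_def invariant4_def)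
  then show ?thesis
    using assms(2) by (auto split: if_splits)
qed

section \<open>Testing equilibrium with purely elastic materials\<close>

lemma equilibrium_elastic_material:
  assumes u: "displacement_field \<Omega> u" and "open \<Omega>" "x \<in> \<Omega>"
    and eq: "equilibrium_on \<Omega> (C, \<lambda>_ _ _ _ _. 0, \<lambda>_ _ _ _ _ _. 0) u"
  shows "(\<Sum>j\<in>UNIV. \<Sum>l\<in>UNIV. \<Sum>m\<in>UNIV. C i j l m * partial j (strain u l m) x) = 0"
proof -
  have partial_sum: "partial j (\<lambda>x. \<Sum>l\<in>UNIV. \<Sum>m\<in>UNIV. C i j l m * strain u l m x) x
      = (\<Sum>l\<in>UNIV. \<Sum>m\<in>UNIV. C i j l m * partial j (strain u l m) x)" for j
  proof -
    have "((\<lambda>x. \<Sum>l\<in>UNIV. \<Sum>m\<in>UNIV. C i j l m * strain u l m x) has_derivative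
        (\<lambda>h. \<Sum>l\<in>UNIV. \<Sum>m\<in>UNIV. C i j l m * (\<Sum>k\<in>UNIV. h$k * partial k (strain u l m) x))) (at x)"
      by (intro derivative_intros has_derivative_partial
          smooth_scalar_on_differentiable[OF smooth_strain[OF u] assms(2,3)] assms)
    from partial_eqI[OF this, of j] show ?thesis
      by (simp add: axis_def if_distribR if_distrib cong: if_cong)
  qed
  have stress: "stress (C, \<lambda>_ _ _ _ _. 0, \<lambda>_ _ _ _ _ _. 0) u i j
      = (\<lambda>x. \<Sum>l\<in>UNIV. \<Sum>m\<in>UNIV. C i j l m * strain u l m x)" for j
    by auto
  have hyperstress: "hyperstress (C, \<lambda>_ _ _ _ _. 0, \<lambda>_ _ _ _ _ _. 0) u i j k = (\<lambda>x. 0)" for j k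
    by auto
  have partial_zero: "partial j (\<lambda>x. 0) = (\<lambda>x. 0)" for j
    by auto
  have "(\<Sum>j\<in>UNIV. partial j (stress (C, \<lambda>_ _ _ _ _. 0, \<lambda>_ _ _ _ _ _. 0) u i j) x) -
     (\<Sum>j\<in>UNIV. \<Sum>k\<in>UNIV. partial k (partial j
       (hyperstress (C, \<lambda>_ _ _ _ _. 0, \<lambda>_ _ _ _ _ _. 0) u i j k)) x) = 0"
    using eq \<open>x \<in> \<Omega>\<close> unfolding equilibrium_on_def by blast
  then show ?thesis
    unfolding stress hyperstress partial_zero partial_sum by simp
qed

text \<open>Building block of the test tensors, chosen as the indicator of an unordered pair so that
  \<open>a = b\<close> gives the value 1 rather than 2.\<close>

definition sym_unit :: "3 \<Rightarrow> 3 \<Rightarrow> 3 \<Rightarrow> 3 \<Rightarrow> real" where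
  "sym_unit a b i j = (if i = a \<and> j = b \<or> i = b \<and> j = a then 1 else 0)"

lemma sym_unit_commute: "sym_unit a b i j = sym_unit a b j i"
  by (auto simp: sym_unit_def)

text \<open>The equation \<open>(i = 3) = (j = 3)\<close> encodes that 3 occurs an even number of
  times in the pair, the parity that governs monoclinic invariance.\<close>

lemma sym_unit_parity:
  assumes "sym_unit a b i j \<noteq> 0"
  shows "((i = 3) = (j = 3)) = ((a = 3) = (b = 3))"
  using assms by (auto simp: sym_unit_def split: if_splits)

lemma sym_unit_product_vanish:
  assumes "((i = 3) = (j = 3)) \<noteq> ((l = 3) = (m = 3))" "((a = 3) = (b = 3)) = ((c = 3) = (d = 3))"
  shows "sym_unit a b i j * sym_unit c d l m = 0"
proof (rule ccontr)
  assume "sym_unit a b i j * sym_unit c d l m \<noteq> 0"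
  then have "((i = 3) = (j = 3)) = ((a = 3) = (b = 3))" "((l = 3) = (m = 3)) = ((c = 3) = (d = 3))"
    by (intro sym_unit_parity; simp)+
  with assms show False
    by (simp only:)
qed

text \<open>The two products are added to give the test tensor its major symmetry. Equal parity of
  the pairs \<open>a b\<close> and \<open>c d\<close> makes all components with an odd number of
  indices 3 vanish, so the material is admissible.\<close>

lemma universal_imp_unit_equilibrium:
  assumes u: "displacement_field \<Omega> u" and "open \<Omega>" "x \<in> \<Omega>" "universal_on \<Omega> monoclinic_Z2 u"
    and parity: "((a = 3) = (b = 3)) = ((c = 3) = (d = 3))"
  shows "(\<Sum>j\<in>UNIV. \<Sum>l\<in>UNIV. \<Sum>m\<in>UNIV.
    (sym_unit a b i j * sym_unit c d l m + sym_unit c d i j * sym_unit a b l m) * partial j (strain u l m) x) = 0"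
proof (rule equilibrium_elastic_material[OF assms(1-3),
      of "\<lambda>i j l m. sym_unit a b i j * sym_unit c d l m + sym_unit c d i j * sym_unit a b l m"])
  have "(\<lambda>i j l m. sym_unit a b i j * sym_unit c d l m + sym_unit c d i j * sym_unit a b l m,
      \<lambda>_ _ _ _ _. 0, \<lambda>_ _ _ _ _ _. 0) \<in> monoclinic_Z2"
    proof (rule elastic_material_in_monoclinic_Z2)
    fix i j l m :: 3
    assume "odd (length (filter ((=) 3) [i, j, l, m]))"
    then have "((i = 3) = (j = 3)) \<noteq> ((l = 3) = (m = 3))"
      by (auto split: if_splits)
    then show "sym_unit a b i j * sym_unit c d l m + sym_unit c d i j * sym_unit a b l m = 0"
      by (simp add: sym_unit_product_vanish parity)
  qed (simp_all add: sym_unit_commute mult_ac add_ac)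
  then show "equilibrium_on \<Omega> (\<lambda>i j l m. sym_unit a b i j * sym_unit c d l m + sym_unit c d i j * sym_unit a b l m,
      \<lambda>_ _ _ _ _. 0, \<lambda>_ _ _ _ _ _. 0) u"
    using assms(4) unfolding universal_on_def by blast
qed

text \<open>Twice the strain gradient of \<open>(x\<^sub>2 x\<^sub>3, - x\<^sub>1 x\<^sub>3, 0)\<close>.\<close>

definition torsion_gradient :: "3 \<Rightarrow> 3 \<Rightarrow> 3 \<Rightarrow> real" where
  "torsion_gradient l m n =
    sym_unit 1 3 l m * (if n = 2 then 1 else 0) - sym_unit 2 3 l m * (if n = 1 then 1 else 0)"

text \<open>Suitable test pairs isolate every strain gradient except e_13,2 and e_23,1. The
  coefficient C_i213 of e_13,2 can be nonzero only for i = 3, and there it equals C_3123, the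
  coefficient of e_23,1. Hence only the sum of these two is forced to vanish.\<close>

lemma universal_imp_strain_gradient:
  assumes u: "displacement_field \<Omega> u" and "open \<Omega>" "x \<in> \<Omega>" "universal_on \<Omega> monoclinic_Z2 u"
  shows "partial n (strain u l m) x = partial 2 (strain u 1 3) x * torsion_gradient l m n"
proof -
  \<comment> \<open>\<open>eq[of a b c d i]\<close> is component \<open>i\<close> of equilibrium for
    the material coupling the pairs \<open>a b\<close> and \<open>c d\<close>.\<close>
  note eq = universal_imp_unit_equilibrium[OF assms]
  note s = strain_commute[of u 2 1] strain_commute[of u 3 1] strain_commute[of u 3 2]
  have "partial 1 (strain u 1 1) x = 0" "partial 2 (strain u 2 2) x = 0" "partial 3 (strain u 3 3) x = 0"
    using eq[of 1 1 1 1 1] eq[of 2 2 2 2 2] eq[of 3 3 3 3 3] by (simp_all add: sym_unit_def sum_3)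
  moreover have "partial 1 (strain u 2 2) x = 0" "partial 2 (strain u 1 1) x = 0"
    using eq[of 1 1 2 2 1] eq[of 1 1 2 2 2] by (simp_all add: sym_unit_def sum_3)
  moreover have "partial 1 (strain u 3 3) x = 0" "partial 3 (strain u 1 1) x = 0"
    using eq[of 1 1 3 3 1] eq[of 1 1 3 3 3] by (simp_all add: sym_unit_def sum_3)
  moreover have "partial 2 (strain u 3 3) x = 0" "partial 3 (strain u 2 2) x = 0"
    using eq[of 2 2 3 3 2] eq[of 2 2 3 3 3] by (simp_all add: sym_unit_def sum_3)
  moreover have "partial 2 (strain u 1 2) x = 0" "partial 1 (strain u 1 2) x = 0" "partial 3 (strain u 1 2) x = 0"
    using eq[of 1 2 1 2 1] eq[of 1 2 1 2 2] eq[of 3 3 1 2 3] by (simp_all add: sym_unit_def sum_3 s)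
  moreover have "partial 3 (strain u 1 3) x = 0" "partial 1 (strain u 1 3) x = 0"
    using eq[of 1 3 1 3 1] eq[of 1 3 1 3 3] by (simp_all add: sym_unit_def sum_3 s)
  moreover have "partial 3 (strain u 2 3) x = 0" "partial 2 (strain u 2 3) x = 0"
    using eq[of 2 3 2 3 2] eq[of 2 3 2 3 3] by (simp_all add: sym_unit_def sum_3 s)
  moreover have "partial 1 (strain u 2 3) x = - partial 2 (strain u 1 3) x"
    using eq[of 1 3 2 3 3] by (simp add: sym_unit_def sum_3 s)
  ultimately show ?thesis
    using exhaust_3[of l] exhaust_3[of m] exhaust_3[of n]
    by (elim disjE) (simp_all add: torsion_gradient_def sym_unit_def s)
qed

section \<open>From the strain gradient to the displacement\<close>

lemma universal_imp_constant_torsion: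
  assumes u: "displacement_field \<Omega> u" and \<Omega>: "open \<Omega>" "connected \<Omega>"
    and univ: "universal_on \<Omega> monoclinic_Z2 u"
  obtains c where "\<And>x. x \<in> \<Omega> \<Longrightarrow> partial 2 (strain u 1 3) x = c / 2"
proof -
  note smooth = smooth_strain[OF u \<Omega>(1)]
  note diff = smooth_scalar_on_differentiable[OF smooth_scalar_on_partial[OF smooth] \<Omega>(1)]
  note grad = universal_imp_strain_gradient[OF u \<Omega>(1) _ univ]
  have "partial i (partial 2 (strain u 1 3)) x = 0" if x: "x \<in> \<Omega>" for i x
  proof -
    \<comment> \<open>Here e_13,i vanishes on \<Omega>, and the two derivatives can be
      exchanged.\<close>
    have "partial i (partial 2 (strain u 1 3)) x = 0" if "i \<noteq> 2" for i
    proof -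
      have "partial i (strain u 1 3) y = 0" if "y \<in> \<Omega>" for y
        using grad[OF that, of i 1 3] \<open>i \<noteq> 2\<close> by (simp add: torsion_gradient_def sym_unit_def)
      then have "partial 2 (partial i (strain u 1 3)) x = 0"
        by (rule partial_zero_on[OF \<Omega>(1) x])
      then show ?thesis
        by (simp only: partial_commute[OF smooth \<Omega>(1) x, where i = i and j = 2])
    qed
    moreover have "partial 2 (partial 2 (strain u 1 3)) x = 0"
    proof -
      \<comment> \<open>In direction 2, e_13,22 = -e_23,12 = -e_23,21 = 0, since e_23,2 vanishes.
        The factors 1 fit the shape of \<open>partial_lincomb\<close>.\<close>
      have 1: "1 * partial 2 (strain u 1 3) y + 1 * partial 1 (strain u 2 3) y = 0"
        and 2: "partial 2 (strain u 2 3) y = 0" if "y \<in> \<Omega>" for y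
        using grad[OF that, of 1 2 3] grad[OF that, of 2 2 3] by (simp_all add: torsion_gradient_def sym_unit_def)
      have "partial 2 (\<lambda>x. 1 * partial 2 (strain u 1 3) x + 1 * partial 1 (strain u 2 3) x) x = 0"
        by (rule partial_zero_on[OF \<Omega>(1) x]) (rule 1)
      moreover have "partial 1 (partial 2 (strain u 2 3)) x = 0"
        by (rule partial_zero_on[OF \<Omega>(1) x]) (rule 2)
      ultimately show ?thesis
        unfolding partial_lincomb[OF diff[OF x] diff[OF x]]
          partial_commute[OF smooth \<Omega>(1) x, where i = 2 and j = 1] by simp
    qed
    ultimately show ?thesis
      by (cases "i = 2") auto
  qed
  then obtain b where "\<And>x. x \<in> \<Omega> \<Longrightarrow> partial 2 (strain u 1 3) x = b"
    using equal_partials_differ_by_const[OF \<Omega>, of "partial 2 (strain u 1 3)" "\<lambda>_. 0"] diff by auto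
  then show thesis
    using that[of "2 * b"] by simp
qed

lemma universal_imp_displacement:
  assumes u: "displacement_field \<Omega> u" and \<Omega>: "open \<Omega>" "connected \<Omega>"
    and univ: "universal_on \<Omega> monoclinic_Z2 u"
  obtains v c where "homogeneous_on \<Omega> v"
    "\<And>x. x \<in> \<Omega> \<Longrightarrow> u x = v x + vector [c * x$2 * x$3, - c * x$1 * x$3, 0]"
proof -
  obtain c where c: "\<And>x. x \<in> \<Omega> \<Longrightarrow> partial 2 (strain u 1 3) x = c / 2"
    using universal_imp_constant_torsion[OF assms] by blast
  \<comment> \<open>This is the value of u_i,jk obtained by inserting the known strain gradient into
    \<open>second_partial_eq_strain_gradients\<close>. Half its quadratic form is the torsion field,
    and the integration constants form \<open>v\<close>.\<close>
  define K where "K i j k = c / 2 * (torsion_gradient i j k + torsion_gradient i k j - torsion_gradient j k i)"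
    for i j k
  have "partial k (partial j (\<lambda>y. u y $ i)) x = K i j k" if x: "x \<in> \<Omega>" for x i j k
    unfolding second_partial_eq_strain_gradients[OF u \<Omega>(1) x]
      universal_imp_strain_gradient[OF u \<Omega>(1) x univ, of k i j]
      universal_imp_strain_gradient[OF u \<Omega>(1) x univ, of j i k]
      universal_imp_strain_gradient[OF u \<Omega>(1) x univ, of i j k] c[OF x] K_def
    by (simp add: algebra_simps)
  moreover have "K i j k = K i k j" for i j k
    by (auto simp: K_def torsion_gradient_def sym_unit_def)
  moreover have "smooth_scalar_on \<Omega> (\<lambda>y. u y $ i)" for i
    using u unfolding displacement_field_def by blast
  ultimately have "\<forall>i. \<exists>b b0. \<forall>x\<in>\<Omega>. u x $ i =
      (\<Sum>j\<in>UNIV. \<Sum>k\<in>UNIV. K i j k * x$j * x$k) / 2 + (\<Sum>j\<in>UNIV. b j * x$j) + b0"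
    by (intro allI, rule_tac f = "\<lambda>y. u y $ i" and K = "K i" in constant_second_partials_imp_quadratic[OF \<Omega>]) blast+
  then obtain b b0 where b: "\<And>i x. x \<in> \<Omega> \<Longrightarrow> u x $ i =
      (\<Sum>j\<in>UNIV. \<Sum>k\<in>UNIV. K i j k * x$j * x$k) / 2 + (\<Sum>j\<in>UNIV. b i j * x$j) + b0 i"
    unfolding choice_iff by blast
  define v where "v x = (\<chi> i j. b i j) *v x + (\<chi> i. b0 i)" for x
  show thesis
  proof
    show "homogeneous_on \<Omega> v"
      unfolding homogeneous_on_def v_def by blast
    show "u x = v x + vector [c * x$2 * x$3, - c * x$1 * x$3, 0]" if x: "x \<in> \<Omega>" for x
      unfolding vec_eq_iff forall_3 b[OF x] v_def
      by (simp add: matrix_vector_mult_def sum_3 K_def torsion_gradient_def sym_unit_def)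
  qed
qed

section \<open>The converse: the stated fields are universal\<close>

lemma strain_torsion:
  assumes "open \<Omega>" "x \<in> \<Omega>"
    and u: "\<And>x. x \<in> \<Omega> \<Longrightarrow> u x = H *v x + b + vector [c * x$2 * x$3, - c * x$1 * x$3, 0]"
  shows "strain u l m x = (H$l$m + H$m$l) / 2 + c / 2 * (\<Sum>n\<in>UNIV. torsion_gradient l m n * x$n)"
proof -
  define D :: "3 \<Rightarrow> real^3 \<Rightarrow> real^3 \<Rightarrow> real" where
    "D l x h = (vector [c * (x$2 * h$3 + h$2 * x$3), - c * (x$1 * h$3 + h$1 * x$3), 0] :: real^3) $ l" for l x h
  have D: "((\<lambda>x. (vector [c * x$2 * x$3, - c * x$1 * x$3, 0] :: real^3) $ l) has_derivative D l x) (at x)"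
    for l x
    using exhaust_3[of l] unfolding D_def
    by (elim disjE) (auto intro!: derivative_eq_intros simp: fun_eq_iff algebra_simps)
  have "partial m (\<lambda>y. u y $ l) x = H$l$m + D l x (axis m 1)" for l m
  proof -
    have "((\<lambda>y. (\<Sum>k\<in>UNIV. H$l$k * y$k) + b$l + (vector [c * y$2 * y$3, - c * y$1 * y$3, 0] :: real^3) $ l)
        has_derivative (\<lambda>h. (\<Sum>k\<in>UNIV. H$l$k * h$k) + 0 + D l x h)) (at x)"
      by (intro derivative_intros D)
    from partial_eqI[OF this, of m] show ?thesis
      using partial_cong[OF assms(1,2), of "\<lambda>y. u y $ l"
          "\<lambda>y. (\<Sum>k\<in>UNIV. H$l$k * y$k) + b$l + (vector [c * y$2 * y$3, - c * y$1 * y$3, 0] :: real^3) $ l" m]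
      by (simp add: u matrix_vector_mult_def axis_def if_distrib cong: if_cong)
  qed
  then show ?thesis
    using exhaust_3[of l] exhaust_3[of m] unfolding strain_def
    by (elim disjE) (simp_all add: D_def axis_def torsion_gradient_def sym_unit_def sum_3)
qed

text \<open>The shape serves both stress and hyper-stress when the strain is affine: the double sum
  is the contraction with the strain, and \<open>d\<close> absorbs the contraction with the constant
  strain gradient.\<close>

lemma partial_affine_strain_combination:
  fixes C :: "3 \<Rightarrow> 3 \<Rightarrow> real" and W :: "3 \<Rightarrow> 3 \<Rightarrow> 3 \<Rightarrow> real"
  assumes "open \<Omega>" "x \<in> \<Omega>"
    and f: "\<And>x. x \<in> \<Omega> \<Longrightarrow>
      f x = (\<Sum>l\<in>UNIV. \<Sum>m\<in>UNIV. C l m * (a l m + c * (\<Sum>n\<in>UNIV. W l m n * x$n))) + d"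
  shows "partial j f x = c * (\<Sum>l\<in>UNIV. \<Sum>m\<in>UNIV. C l m * W l m j)"
proof -
  have "((\<lambda>x. (\<Sum>l\<in>UNIV. \<Sum>m\<in>UNIV. C l m * (a l m + c * (\<Sum>n\<in>UNIV. W l m n * x$n))) + d) has_derivative
      (\<lambda>h. (\<Sum>l\<in>UNIV. \<Sum>m\<in>UNIV. C l m * (0 + c * (\<Sum>n\<in>UNIV. W l m n * h$n))) + 0)) (at x)"
    by (intro derivative_intros)
  from partial_eqI[OF this, of j] show ?thesis
    using partial_cong[OF assms, where i = j]
    by (simp add: axis_def if_distrib sum_distrib_left mult_ac cong: if_cong)
qed

lemma torsion_universal:
  assumes \<Omega>: "open \<Omega>"
    and u: "\<And>x. x \<in> \<Omega> \<Longrightarrow> u x = H *v x + b + vector [c * x$2 * x$3, - c * x$1 * x$3, 0]"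
  shows "universal_on \<Omega> monoclinic_Z2 u"
  unfolding universal_on_def equilibrium_on_def
proof (intro ballI allI)
  fix S x i assume S: "S \<in> monoclinic_Z2" and x: "x \<in> \<Omega>"
  obtain C M A where S_eq: "S = (C, M, A)"
    by (cases S)
  note strain = strain_torsion[OF \<Omega> _ u]
  define W where "W = torsion_gradient"
  have grad: "partial n (strain u l m) x = c / 2 * W l m n" if "x \<in> \<Omega>" for l m n x
  proof -
    have "((\<lambda>x. (H$l$m + H$m$l) / 2 + c / 2 * (\<Sum>n\<in>UNIV. W l m n * x$n)) has_derivative
        (\<lambda>h. 0 + c / 2 * (\<Sum>n\<in>UNIV. W l m n * h$n))) (at x)"
      by (intro derivative_intros)
    from partial_eqI[OF this, of n] show ?thesis
      using partial_cong[OF \<Omega> that strain, where i = n]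
      by (simp add: W_def axis_def if_distrib cong: if_cong)
  qed
  have "partial j (stress S u i j) x = c / 2 * (\<Sum>l\<in>UNIV. \<Sum>m\<in>UNIV. C i j l m * W l m j)" for j
    by (rule partial_affine_strain_combination[OF \<Omega> x])
      (simp add: S_eq strain grad W_def)
  \<comment> \<open>The hyper-stress is affine on \<Omega>, so its first derivatives are constant
    there.\<close>
  moreover have "partial k (partial j (hyperstress S u i j k)) x = 0" for j k
  proof -
    have "partial j (hyperstress S u i j k) y = c / 2 * (\<Sum>l\<in>UNIV. \<Sum>m\<in>UNIV. M l m i j k * W l m j)"
      if "y \<in> \<Omega>" for y
      by (rule partial_affine_strain_combination[OF \<Omega> that])
        (simp add: S_eq strain grad W_def)
    from partial_cong[OF \<Omega> x this] show ?thesis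
      by simp
  qed
  moreover have "(\<Sum>j\<in>UNIV. \<Sum>l\<in>UNIV. \<Sum>m\<in>UNIV. C i j l m * W l m j) = 0"
  proof -
    note van = monoclinic_Z2_elasticity_vanish[OF S[unfolded S_eq]]
    have sym: "C i j l m = C j i l m" "C i j l m = C l m i j" for i j l m
      using S unfolding S_eq monoclinic_Z2_def strain_gradient_materials_def by blast+
    \<comment> \<open>These are the components left after contraction with \<open>W\<close>. For
      \<open>i = 3\<close> the index symmetries make all four equal; otherwise each contains exactly
      one index 3 and vanishes.\<close>
    have "C i 2 1 3 + C i 2 3 1 = C i 1 2 3 + C i 1 3 2"
    proof (cases "i = 3")
      case True
      then show ?thesis
        using sym by metis
    next
      case False
      then show ?thesis
        by (simp add: van)
    qed
    then show ?thesis
      by (simp add: sum_3 W_def torsion_gradient_def sym_unit_def)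
  qed
  ultimately show "(\<Sum>j\<in>UNIV. partial j (stress S u i j) x) -
      (\<Sum>j\<in>UNIV. \<Sum>k\<in>UNIV. partial k (partial j (hyperstress S u i j k)) x) = 0"
    by (simp only: sum.neutral_const diff_zero mult_zero_right flip: sum_distrib_left)
qed

theorem proposition3p3:
  fixes \<Omega> :: "(real^3) set" and u :: "real^3 \<Rightarrow> real^3"
  assumes "\<Omega> \<noteq> {}" and "open \<Omega>" and "convex \<Omega>"
    and "displacement_field \<Omega> u"
  shows "universal_on \<Omega> monoclinic_Z2 u \<longleftrightarrow>
    (\<exists>v c. homogeneous_on \<Omega> v \<and>
      (\<forall>x\<in>\<Omega>. u x = v x + vector [c * x$2 * x$3, - c * x$1 * x$3, 0]))"
proof
  assume "universal_on \<Omega> monoclinic_Z2 u"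
  then show "\<exists>v c. homogeneous_on \<Omega> v \<and>
      (\<forall>x\<in>\<Omega>. u x = v x + vector [c * x$2 * x$3, - c * x$1 * x$3, 0])"
    using universal_imp_displacement[OF assms(4,2) convex_connected[OF assms(3)]] by metis
next
  assume "\<exists>v c. homogeneous_on \<Omega> v \<and>
      (\<forall>x\<in>\<Omega>. u x = v x + vector [c * x$2 * x$3, - c * x$1 * x$3, 0])"
  then show "universal_on \<Omega> monoclinic_Z2 u"
    using torsion_universal[OF assms(2)] unfolding homogeneous_on_def by metis
qed

end
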